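(* Let $t=t(n)$ and $b=b(n)$ be such that $t,b\in\big[\binom{n}{2}\big]$ and $t=o(n^2)$. For all $k_0\in\mathbb{N}$ and $\epsilon>0$ there exist $\lambda>0$ and $n_0\in\mathbb{N}$ such that, for all $n\geq n_0$, the following holds. Let $B_t$ be produced by the budget-constrained random graph process under a $(t,b)$-strategy. Then, with probability at least $1-\epsilon$, there exists a set of vertices $V\subseteq[n]$ with $|V|\geq(1-\epsilon)n$ such that, for every connected graph $F$ on at most $k_0$ vertices and every vertex $v\in V$, the number of copies of $F$ in $B_t[V]$ containing $v$ is at most $\lambda\, b^{v(F)-1}t^{e(F)-v(F)+1}n^{v(F)-2e(F)-1}$.
   Context: Budget-constrained random graph process: let $M=\binom{n}{2}$. The edges of $K_n$ on vertex set $[n]$ are put in a uniformly random order $e_1,e_2,\ldots,e_M$. Builder is presented $e_1,\ldots,e_t$ one by one and, as each edge is presented and without knowledge of future edges, must irrevocably decide (possibly using additional randomness) whether to purchase it; she may purchase at most $b$ edges in total. A $(t,b)$-strategy is any such rule; $B_t$ denotes the graph of purchased edges after time $t$. $v(F)$ and $e(F)$ denote the numbers of vertices and edges of $F$; $B_t[V]$ is the induced subgraph on $V$. Copies of $F$ are counted as labelled copies, i.e. injective graph homomorphisms $F\to B_t[V]$. *)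

theory Defs
  imports "HOL-Probability.Probability" "HOL-Combinatorics.Multiset_Permutations"
    "HOL-Library.Landau_Symbols"
begin

definition edges_K :: "nat \<Rightarrow> nat set set" where
  "edges_K n = {e. e \<subseteq> {1..n} \<and> card e = 2}"

text \<open>
  A deterministic rule is applied to the nonempty list of all edges presented so far, the current
  one last, and says whether the current edge is bought. Earlier decisions need not be passed to it:
  they are determined by the rule and the earlier edges.
\<close>

type_synonym rule = "nat set list \<Rightarrow> bool"

definition purchased :: "rule \<Rightarrow> nat set list \<Rightarrow> nat \<Rightarrow> nat set set" where
  "purchased f es t = {es ! i | i. i < t \<and> i < length es \<and> f (take (Suc i) es)}"

text \<open>
  Builder's additional randomness is a seed that is independent of the order of the edges; fixing the
  seed leaves a deterministic rule. So a randomized rule is a distribution on deterministic rules.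
  For fixed \<open>n\<close> only finitely many histories, hence finitely many restricted rules, matter, so
  discrete distributions cover seeds from arbitrary probability spaces, and in particular fresh
  randomness at each step. The budget is respected with certainty.
\<close>

definition is_strategy :: "nat \<Rightarrow> nat \<Rightarrow> nat \<Rightarrow> rule pmf \<Rightarrow> bool" where
  "is_strategy n t b S \<longleftrightarrow>
     (\<forall>f\<in>set_pmf S. \<forall>es\<in>permutations_of_set (edges_K n). card (purchased f es t) \<le> b)"

text \<open>The law of the edge set of \<open>B\<^sub>t\<close>; the vertex set is \<open>{1..n}\<close>.\<close>

definition built_graph :: "nat \<Rightarrow> nat \<Rightarrow> rule pmf \<Rightarrow> nat set set pmf" where
  "built_graph n t S =
     map_pmf (\<lambda>(f, es). purchased f es t)
       (pair_pmf S (pmf_of_set (permutations_of_set (edges_K n))))"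

definition simple_graph :: "'a set \<Rightarrow> 'a set set \<Rightarrow> bool" where
  "simple_graph W D \<longleftrightarrow> finite W \<and> (\<forall>e\<in>D. e \<subseteq> W \<and> card e = 2)"

definition connected_graph :: "'a set \<Rightarrow> 'a set set \<Rightarrow> bool" where
  "connected_graph W D \<longleftrightarrow>
     simple_graph W D \<and> W \<noteq> {} \<and> (\<forall>x\<in>W. \<forall>y\<in>W. (x, y) \<in> {(u, w). {u, w} \<in> D}\<^sup>*)"

definition induced_edges :: "'a set set \<Rightarrow> 'a set \<Rightarrow> 'a set set" where
  "induced_edges E V = {e \<in> E. e \<subseteq> V}"

text \<open>Labelled copies of the graph \<open>(W, D)\<close> in the graph \<open>(V, E)\<close>.\<close>

definition copies :: "'a set \<Rightarrow> 'a set set \<Rightarrow> 'b set \<Rightarrow> 'b set set \<Rightarrow> ('a \<Rightarrow> 'b) set" where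
  "copies W D V E = {\<phi> \<in> W \<rightarrow>\<^sub>E V. inj_on \<phi> W \<and> (\<forall>e\<in>D. \<phi> ` e \<in> E)}"

definition copies_at :: "'a set \<Rightarrow> 'a set set \<Rightarrow> 'b set \<Rightarrow> 'b set set \<Rightarrow> 'b \<Rightarrow> ('a \<Rightarrow> 'b) set" where
  "copies_at W D V E v = {\<phi> \<in> copies W D V E. v \<in> \<phi> ` W}"

end

theory Submission
  imports Defs
begin

text \<open>
  Fix a deterministic rule and run the process while deleting, irrevocably, each vertex as soon as it
  lies in more than \<open>K * mu(F) * weight(F)\<close> copies of some connected graph \<open>F\<close> with at most \<open>k\<close>
  vertices, counted among the vertices not yet deleted; here \<open>weight(F)\<close> is the claimed bound without
  its constant. The expected number of copies of \<open>F\<close> that are ever present among undeleted vertices is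
  at most \<open>mu(F) * n * weight(F)\<close>, by induction on the number of edges according to the edge \<open>f\<close> of
  the copy that arrives last. If \<open>F - f\<close> is connected, then for each copy of \<open>F - f\<close> the missing pair
  must still be presented, which has conditional probability at most \<open>t / (n choose 2)\<close>. If \<open>f\<close> is a
  bridge, the copy arises at one of the at most \<open>b\<close> purchases by joining a copy of each component,
  and at each end their number is controlled by the deletion rule. Hence few vertices are deleted in
  expectation when \<open>K\<close> is large, and Markov's inequality applies.
\<close>

subsection \<open>A uniformly random order\<close>

text \<open>
  Deleting \<open>g\<close> from the order leaves an order of the other elements, and given the latter the position
  of \<open>g\<close> is uniform; \<open>P\<close> marks a stopping time \<open>s\<close>, and \<open>(t - s) / (card E - s) \<le> t / card E\<close>.
\<close>

lemma card_prefix_then_element_le: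
  fixes E :: "'a set" and P :: "'a list \<Rightarrow> bool"
  assumes fin: "finite E" and g: "g \<in> E" and t: "t \<le> card E"
  shows "card {es \<in> permutations_of_set E. \<exists>q<t. es ! q = g \<and> P (take q es)} * card E
    \<le> t * card {es \<in> permutations_of_set E. \<exists>q\<le>t. P (take q es)}"
    (is "card ?A * _ \<le> t * card ?B")
proof -
  define R where "R = permutations_of_set (E - {g})"
  define m where "m = card E"
  \<comment> \<open>Here \<open>r\<close> is an order of the elements other than \<open>g\<close>,
    and \<open>ins\<close> puts \<open>g\<close> back at position \<open>j\<close>. Positions in
    \<open>J1 r\<close> yield the orders counted on the left. Positions in \<open>J2 r\<close> come
    after a prefix satisfying \<open>P\<close> of length at most \<open>t\<close>; that prefix
    survives the insertion, so they yield orders counted on the right.\<close>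
  define J1 where "J1 = (\<lambda>r::'a list. {j. j < t \<and> P (take j r)})"
  define J2 where "J2 = (\<lambda>r::'a list. {j. j < m \<and> (\<exists>q\<le>t. q \<le> j \<and> P (take q r))})"
  define ins where "ins = (\<lambda>(r, j). take j r @ g # drop j r)"
  have finR: "finite R" and finJ: "\<And>r. finite (J1 r)" "\<And>r. finite (J2 r)"
    by (auto simp: R_def J1_def J2_def)
  have lenR: "length r = m - 1" "g \<notin> set r" "distinct r" "set r = E - {g}" if "r \<in> R" for r
    using that fin g
    by (auto simp: R_def m_def length_finite_permutations_of_set dest: permutations_of_setD)
  have m: "m \<ge> 1" using g fin by (auto simp: m_def Suc_le_eq card_gt_0_iff)
  have A_sub: "?A \<subseteq> ins ` (SIGMA r:R. J1 r)"
  proof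
    fix es assume es: "es \<in> ?A"
    then obtain q where q: "q < t" "es ! q = g" "P (take q es)" by auto
    have d: "distinct es" "set es = E" using es by (auto dest: permutations_of_setD)
    have len: "q < length es"
      using es q(1) t by (auto simp: length_finite_permutations_of_set)
    define r where "r = take q es @ drop (Suc q) es"
    have split: "es = take q es @ g # drop (Suc q) es"
      using len q(2) by (metis id_take_nth_drop)
    have "distinct (take q es @ g # drop (Suc q) es)" "set (take q es @ g # drop (Suc q) es) = E"
      using d split by metis+
    then have "r \<in> R" unfolding R_def r_def
      by (intro permutations_of_setI) auto
    moreover have "take q r = take q es" using len by (simp add: r_def)
    moreover have "ins (r, q) = es" using len split by (simp add: ins_def r_def)
    ultimately show "es \<in> ins ` (SIGMA r:R. J1 r)"
      using q by (intro image_eqI[of _ _ "(r, q)"]) (auto simp: J1_def)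
  qed
  have B_sup: "ins ` (SIGMA r:R. J2 r) \<subseteq> ?B"
  proof clarify
    fix r j assume r: "r \<in> R" and "j \<in> J2 r"
    then obtain q where q: "j < m" "q \<le> t" "q \<le> j" "P (take q r)" by (auto simp: J2_def)
    have j: "j \<le> length r" using lenR[OF r] q m by auto
    have "distinct (take j r @ drop j r)" "set (take j r @ drop j r) = E - {g}"
      using lenR[OF r] by simp_all
    then have "ins (r, j) \<in> permutations_of_set E"
      using lenR(2)[OF r] g unfolding ins_def
      by (intro permutations_of_setI)
        (auto simp del: append_take_drop_id dest: in_set_takeD in_set_dropD)
    moreover have "take q (ins (r, j)) = take q r" using q j by (simp add: ins_def min_def)
    ultimately show "ins (r, j) \<in> permutations_of_set E \<and> (\<exists>q\<le>t. P (take q (ins (r, j))))"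
      using q by auto
  qed
  have inj: "inj_on ins (SIGMA r:R. J2 r)"
  \<comment> \<open>The element \<open>g\<close> occurs in neither half of \<open>r\<close>, so
    cutting the list at \<open>g\<close> recovers both halves and hence the position.\<close>
  proof (rule inj_onI, clarify)
    fix r j r' j' assume a: "r \<in> R" "j \<in> J2 r" "r' \<in> R" "j' \<in> J2 r'" "ins (r, j) = ins (r', j')"
    then have l: "j \<le> length r" "j' \<le> length r'"
      using lenR(1)[OF a(1)] lenR(1)[OF a(3)] m by (auto simp: J2_def)
    have "g \<notin> set (take j r)" "g \<notin> set (take j' r')" "g \<notin> set (drop j r)" "g \<notin> set (drop j' r')"
      using lenR(2) a(1,3) by (auto dest: in_set_takeD in_set_dropD)
    then have "take j r = take j' r' \<and> drop j r = drop j' r'"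
      using a(5) by (simp add: ins_def append_Cons_eq_iff)
    then show "r = r' \<and> j = j'"
      using l by (metis append_take_drop_id length_take min.absorb2)
  qed
  have "card ?A \<le> card (SIGMA r:R. J1 r)"
    using A_sub finR finJ by (meson card_image_le card_mono finite_SigmaI finite_imageI le_trans)
  also have "\<dots> = (\<Sum>r\<in>R. card (J1 r))" using finR finJ by simp
  finally have 1: "card ?A * m \<le> (\<Sum>r\<in>R. card (J1 r) * m)" by (simp add: sum_distrib_right[symmetric])
  have per: "card (J1 r) * m \<le> t * card (J2 r)" for r
  proof (cases "J1 r = {}")
    case False
    \<comment> \<open>The stopping time of \<open>r\<close>: insertions counted in
      \<open>J1 r\<close> happen at or after \<open>s\<close>, while every position from
      \<open>s\<close> on belongs to \<open>J2 r\<close>.\<close>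
    define s where "s = (LEAST q. P (take q r))"
    from False obtain j where j: "j < t" "P (take j r)" by (auto simp: J1_def)
    have s: "P (take s r)" "s \<le> j" and least: "\<And>q. P (take q r) \<Longrightarrow> s \<le> q"
      using j by (auto simp: s_def intro: LeastI Least_le)
    have "J1 r \<subseteq> {s..<t}" using least by (auto simp: J1_def)
    then have c1: "card (J1 r) \<le> t - s" by (metis card_atLeastLessThan card_mono finite_atLeastLessThan)
    have "{s..<m} \<subseteq> J2 r" using s j by (auto simp: J2_def intro!: exI[of _ s])
    then have c2: "m - s \<le> card (J2 r)" by (metis card_atLeastLessThan card_mono finJ(2))
    have "card (J1 r) * m \<le> (t - s) * m" using c1 by simp
    \<comment> \<open>After expansion this is \<open>t * s \<le> m * s\<close>, which holds because
      \<open>t \<le> m\<close>.\<close>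
    also have "\<dots> \<le> t * (m - s)"
      using t by (simp add: m_def diff_mult_distrib diff_mult_distrib2 mult.commute diff_le_mono2)
    also have "\<dots> \<le> t * card (J2 r)" using c2 by simp
    finally show ?thesis .
  qed simp
  have "(\<Sum>r\<in>R. card (J1 r) * m) \<le> (\<Sum>r\<in>R. t * card (J2 r))" by (intro sum_mono per)
  also have "\<dots> = t * card (SIGMA r:R. J2 r)" using finR finJ by (simp add: sum_distrib_left)
  also have "card (SIGMA r:R. J2 r) = card (ins ` (SIGMA r:R. J2 r))" using inj by (simp add: card_image)
  also have "\<dots> \<le> card ?B" using B_sup by (intro card_mono) auto
  finally show ?thesis using 1 by (simp add: m_def)
qed

subsection \<open>Copies and connected graphs\<close>

lemma card_edges_K: "card (edges_K n) = n choose 2"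
  using n_subsets[of "{1..n}" 2] by (simp add: edges_K_def)

lemma finite_edges_K [simp]: "finite (edges_K n)"
  by (rule finite_subset[of _ "Pow {1..n}"]) (auto simp: edges_K_def)

lemma finite_copies [simp]: "finite W \<Longrightarrow> finite V \<Longrightarrow> finite (copies W D V E)"
  by (rule finite_subset[of _ "W \<rightarrow>\<^sub>E V"]) (auto simp: copies_def intro: finite_PiE)

lemma finite_copies_at [simp]: "finite W \<Longrightarrow> finite V \<Longrightarrow> finite (copies_at W D V E v)"
  by (simp add: copies_at_def)

lemma copies_mono: "D' \<subseteq> D \<Longrightarrow> V \<subseteq> V' \<Longrightarrow> E \<subseteq> E' \<Longrightarrow> copies W D V E \<subseteq> copies W D' V' E'"
  unfolding copies_def PiE_def Pi_def by blast

lemma copies_at_mono: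
  "D' \<subseteq> D \<Longrightarrow> V \<subseteq> V' \<Longrightarrow> E \<subseteq> E' \<Longrightarrow> copies_at W D V E v \<subseteq> copies_at W D' V' E' v"
  unfolding copies_at_def using copies_mono[of D' D V V' E E' W] by blast

lemma simple_graph_finite_edges: "simple_graph W D \<Longrightarrow> finite D"
  by (rule finite_subset[of _ "Pow W"]) (auto simp: simple_graph_def)

text \<open>A crude count of subsets is enough: it serves to replace \<open>mu K (card D)\<close> by
  one constant for all graphs on at most \<open>k\<close> vertices.\<close>

lemma simple_graph_card_edges_le:
  assumes "simple_graph W D" shows "card D \<le> 2 ^ card W"
proof -
  have "D \<subseteq> Pow W" "finite W" using assms by (auto simp: simple_graph_def)
  then show ?thesis by (metis card_Pow card_mono finite_Pow_iff)
qed

lemma simple_graph_edgeE: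
  assumes "simple_graph W D" "e \<in> D"
  obtains u w where "e = {u, w}" "u \<noteq> w" "u \<in> W" "w \<in> W"
proof -
  have "card e = 2" "e \<subseteq> W" using assms by (auto simp: simple_graph_def)
  then show ?thesis using that unfolding card_2_iff by (elim exE conjE) simp
qed

section \<open>Connected components and the removal of an edge\<close>

definition reach :: "'a set set \<Rightarrow> 'a \<Rightarrow> 'a set" where
  "reach D x = {z. (x, z) \<in> {(u, w). {u, w} \<in> D}\<^sup>*}"

lemma reach_refl [simp]: "x \<in> reach D x"
  by (simp add: reach_def)

lemma reach_step: "z \<in> reach D x \<Longrightarrow> {z, w} \<in> D \<Longrightarrow> w \<in> reach D x"
  by (auto simp: reach_def intro: rtrancl.rtrancl_into_rtrancl)

lemma reach_sym: "z \<in> reach D x \<Longrightarrow> x \<in> reach D z"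
proof -
  have "sym {(u, w). {u, w} \<in> D}" by (auto simp: sym_def insert_commute)
  then show "z \<in> reach D x \<Longrightarrow> x \<in> reach D z"
    unfolding reach_def by (metis mem_Collect_eq sym_rtrancl symD)
qed

lemma reach_trans: "z \<in> reach D x \<Longrightarrow> w \<in> reach D z \<Longrightarrow> w \<in> reach D x"
  by (auto simp: reach_def)

lemma reach_induct [consumes 1, case_names refl step]:
  assumes "z \<in> reach D x" "P x" "\<And>z w. z \<in> reach D x \<Longrightarrow> P z \<Longrightarrow> {z, w} \<in> D \<Longrightarrow> P w"
  shows "P z"
  using assms(1) unfolding reach_def mem_Collect_eq
  by (induction rule: rtrancl_induct) (use assms(2,3) in \<open>auto simp: reach_def\<close>)

lemma connected_graph_reach:
  "connected_graph W D \<longleftrightarrow> simple_graph W D \<and> W \<noteq> {} \<and> (\<forall>x\<in>W. W \<subseteq> reach D x)"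
  by (auto simp: connected_graph_def reach_def)

text \<open>A path from \<open>x\<close> visits only vertices of \<open>reach D x\<close>, so all
  its edges survive the restriction to that set.\<close>

lemma connected_component:
  assumes "simple_graph W D" "x \<in> W"
  shows "connected_graph (reach D x) {e \<in> D. e \<subseteq> reach D x}" and "reach D x \<subseteq> W"
proof -
  define D' where "D' = {e \<in> D. e \<subseteq> reach D x}"
  have sub: "z \<in> W" if "z \<in> reach D x" for z
    using that
  proof (induction rule: reach_induct)
    case (step z w)
    then show ?case using assms(1) unfolding simple_graph_def by (metis insert_subset)
  qed (rule assms(2))
  then show W: "reach D x \<subseteq> W" by auto
  have "z \<in> reach D' x" if "z \<in> reach D x" for z
    using that
  proof (induction rule: reach_induct)
    case (step z w)
    then have "{z, w} \<in> D'" using reach_step[of z D x w] by (simp add: D'_def)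
    then show ?case using step.IH reach_step[of z D' x w] by simp
  qed simp
  then have "\<forall>u\<in>reach D x. reach D x \<subseteq> reach D' u"
    by (intro ballI subsetI) (rule reach_trans[OF reach_sym])
  moreover have "reach D x \<noteq> {}" using reach_refl[of x D] by blast
  moreover have "finite (reach D x)"
    using assms(1) finite_subset[OF W] unfolding simple_graph_def by blast
  then have "simple_graph (reach D x) D'"
    using assms(1) unfolding simple_graph_def D'_def by blast
  ultimately show "connected_graph (reach D x) {e \<in> D. e \<subseteq> reach D x}"
    unfolding connected_graph_reach D'_def[symmetric] by (intro conjI)
qed

text \<open>Without \<open>f = {x, y}\<close> every vertex is still reachable from \<open>x\<close>
  or from \<open>y\<close>, and these two components either coincide or are disjoint. This is the
  case distinction of the main induction, applied to the edge that arrives last.\<close>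

lemma connected_remove_edge:
  assumes con: "connected_graph W D" and f: "f \<in> D"
  obtains (cycle) "connected_graph W (D - {f})"
  | (bridge) x y W1 D1 W2 D2 where "f = {x, y}" "x \<in> W1" "y \<in> W2"
      "connected_graph W1 D1" "connected_graph W2 D2"
      "W = W1 \<union> W2" "W1 \<inter> W2 = {}" "D - {f} = D1 \<union> D2" "D1 \<inter> D2 = {}"
proof -
  have sg: "simple_graph W D" and ne: "W \<noteq> {}" using con by (auto simp: connected_graph_def)
  obtain x y where f_eq: "f = {x, y}" and xy: "x \<noteq> y" "x \<in> W" "y \<in> W"
    using sg f by (rule simple_graph_edgeE)
  let ?D = "D - {f}"
  have sg': "simple_graph W ?D" using sg by (auto simp: simple_graph_def)
  \<comment> \<open>Follow a path of \<open>D\<close> from \<open>x\<close>: traversing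
    \<open>f\<close> leads to \<open>x\<close> or \<open>y\<close>, and any other edge stays inside
    the current component.\<close>
  have "z \<in> reach ?D x \<union> reach ?D y" if "z \<in> reach D x" for z
    using that
  proof (induction rule: reach_induct)
    case (step z w)
    show ?case
    proof (cases "{z, w} = f")
      case True
      then have "w = x \<or> w = y" by (auto simp: f_eq doubleton_eq_iff)
      then show ?thesis by auto
    next
      case False
      then show ?thesis using step reach_step[of z ?D _ w] by auto
    qed
  qed simp
  then have cover: "W \<subseteq> reach ?D x \<union> reach ?D y"
    using con xy unfolding connected_graph_reach by blast
  show thesis
  proof (cases "y \<in> reach ?D x")
    case True
    then have "W \<subseteq> reach ?D x" using cover reach_trans[OF True] by blast
    then have "\<forall>u\<in>W. W \<subseteq> reach ?D u"
      by (intro ballI subsetI) (rule reach_trans[OF reach_sym], auto)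
    then show ?thesis using cycle sg' ne by (simp add: connected_graph_reach)
  next
    case False
    have disj: "reach ?D x \<inter> reach ?D y = {}"
      using False reach_sym reach_trans by (metis disjoint_iff)
    have W: "W = reach ?D x \<union> reach ?D y"
      using cover connected_component(2)[OF sg' xy(2)] connected_component(2)[OF sg' xy(3)]
      by (intro equalityI Un_least)
    have edge: "e \<subseteq> reach ?D x \<or> e \<subseteq> reach ?D y" if e: "e \<in> ?D" for e
    proof -
      obtain u w where uw: "e = {u, w}" "u \<in> W" "w \<in> W"
        using sg' e by (rule simple_graph_edgeE)
      then have "u \<in> reach ?D x \<or> u \<in> reach ?D y" using cover by blast
      then show ?thesis using uw e reach_step[of u ?D _ w] by auto
    qed
    let ?D1 = "{e \<in> ?D. e \<subseteq> reach ?D x}" and ?D2 = "{e \<in> ?D. e \<subseteq> reach ?D y}"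
    have "?D1 \<inter> ?D2 = {}"
    proof (rule Int_emptyI)
      fix e assume "e \<in> ?D1" "e \<in> ?D2"
      then have "e \<subseteq> reach ?D x \<inter> reach ?D y" "card e = 2"
        using sg' by (simp_all add: simple_graph_def)
      then show False using disj by simp
    qed
    moreover have "?D = ?D1 \<union> ?D2"
    proof (intro equalityI subsetI)
      fix e assume "e \<in> ?D"
      then show "e \<in> ?D1 \<union> ?D2" using edge[of e] by simp
    next
      fix e assume "e \<in> ?D1 \<union> ?D2"
      then show "e \<in> ?D" by (elim UnE) simp_all
    qed
    ultimately show ?thesis
      by (rule bridge[OF f_eq reach_refl reach_refl connected_component(1)[OF sg' xy(2)]
            connected_component(1)[OF sg' xy(3)] W disj, rotated])
  qed
qed

subsection \<open>Deleting overfull vertices\<close>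

lemma sum_card_swap:
  assumes "finite A" "finite B"
  shows "(\<Sum>a\<in>A. card {b \<in> B. R a b}) = (\<Sum>b\<in>B. card {a \<in> A. R a b})"
  unfolding card_eq_sum using assms by (rule sum.swap_restrict)

definition small_connected :: "nat \<Rightarrow> (nat set \<times> nat set set) set" where
  "small_connected k = {(W, D). W \<subseteq> {..<k} \<and> connected_graph W D}"

lemma finite_small_connected: "finite (small_connected k)"
proof (rule finite_subset)
  show "small_connected k \<subseteq> Pow {..<k} \<times> Pow (Pow {..<k})"
    unfolding small_connected_def connected_graph_def simple_graph_def by fast
qed simp

text \<open>This equals (b/n)^(v-1) times (t/n^2)^(e-v+1): a factor b/n for each edge of a spanning
  tree and a factor t/n^2 for each further edge. Integer powers are used because the exponent of
  \<open>n\<close> can be negative.\<close>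

definition weight :: "nat \<Rightarrow> nat \<Rightarrow> nat \<Rightarrow> nat \<Rightarrow> nat \<Rightarrow> real" where
  "weight n t b v e = real b powi (int v - 1) * real t powi (int e - int v + 1)
    * real n powi (int v - 2 * int e - 1)"

lemma weight_pos: "n > 0 \<Longrightarrow> t > 0 \<Longrightarrow> b > 0 \<Longrightarrow> weight n t b v e > 0"
  by (simp add: weight_def)

text \<open>An edge that closes a cycle costs a factor t/n^2, written here without division.\<close>

lemma weight_add_edge:
  assumes "n > 0" "t > 0"
  shows "weight n t b v (Suc e) * real n ^ 2 = weight n t b v e * real t"
proof -
  have 1: "int (Suc e) - int v + 1 = (int e - int v + 1) + 1" by simp
  have 2: "int v - 2 * int e - 1 = (int v - 2 * int (Suc e) - 1) + 2" by simp
  have "real t powi (int (Suc e) - int v + 1) = real t powi (int e - int v + 1) * real t"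
    unfolding 1 using assms by (subst power_int_add) auto
  moreover have "real n powi (int v - 2 * int e - 1)
      = real n powi (int v - 2 * int (Suc e) - 1) * real n ^ 2"
    unfolding 2 using assms by (subst power_int_add) auto
  ultimately show ?thesis by (simp add: weight_def)
qed

text \<open>A bridge counts as a tree edge: (v-1) + (v'-1) + 1 = v+v'-1, and the cycle ranks e-v+1
  and e'-v'+1 add up. On the left are the number of purchases and the weights attached at the two
  ends of the bridge.\<close>

lemma weight_join:
  assumes "n > 0" "t > 0" "b > 0"
  shows "real b * weight n t b v e * weight n t b v' e' = real n * weight n t b (v + v') (Suc (e + e'))"
proof -
  have 1: "int (v + v') - 1 = 1 + (int v - 1) + (int v' - 1)" by simp
  have 2: "int (Suc (e + e')) - int (v + v') + 1 = (int e - int v + 1) + (int e' - int v' + 1)" by simp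
  have 3: "(int v - 2 * int e - 1) + (int v' - 2 * int e' - 1)
      = 1 + (int (v + v') - 2 * int (Suc (e + e')) - 1)" by simp
  have "real b powi (int (v + v') - 1) = real b * real b powi (int v - 1) * real b powi (int v' - 1)"
  proof -
    have "real b powi (1 + (int v - 1) + (int v' - 1))
        = real b powi (1 + (int v - 1)) * real b powi (int v' - 1)"
      using assms by (intro power_int_add) auto
    also have "real b powi (1 + (int v - 1)) = real b powi 1 * real b powi (int v - 1)"
      using assms by (intro power_int_add) auto
    finally show ?thesis unfolding 1 by simp
  qed
  moreover have "real t powi (int (Suc (e + e')) - int (v + v') + 1)
      = real t powi (int e - int v + 1) * real t powi (int e' - int v' + 1)"
    unfolding 2 using assms by (subst power_int_add) auto
  moreover have "real n powi (int v - 2 * int e - 1) * real n powi (int v' - 2 * int e' - 1)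
      = real n * real n powi (int (v + v') - 2 * int (Suc (e + e')) - 1)"
  proof -
    have "real n powi (int v - 2 * int e - 1) * real n powi (int v' - 2 * int e' - 1)
      = real n powi ((int v - 2 * int e - 1) + (int v' - 2 * int e' - 1))"
      using assms by (subst power_int_add) auto
    also have "\<dots> = real n * real n powi (int (v + v') - 2 * int (Suc (e + e')) - 1)"
      unfolding 3 using assms by (subst power_int_add) auto
    finally show ?thesis .
  qed
  ultimately show ?thesis unfolding weight_def by (simp add: mult_ac)
qed

text \<open>
  \<open>mu K e\<close> bounds the normalized expected number of copies with \<open>e\<close> edges. Each choice of the last
  edge contributes \<open>4 * mu K (e - 1)\<close> if it closes a cycle and \<open>2 * (K * mu K (e - 1))\<^sup>2\<close> if it is
  a bridge.
\<close>

primrec mu :: "real \<Rightarrow> nat \<Rightarrow> real" where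
  "mu K 0 = 1"
| "mu K (Suc e) = real (Suc e) * (4 * mu K e + 2 * (K * mu K e) ^ 2)"

lemma mu_ge_1: "1 \<le> mu K e"
proof (induction e)
  case (Suc e)
  have "1 \<le> 4 * mu K e + 2 * (K * mu K e) ^ 2" using Suc by (simp add: add_increasing2)
  then have "1 * 1 \<le> real (Suc e) * (4 * mu K e + 2 * (K * mu K e) ^ 2)"
    by (intro mult_mono) auto
  then show ?case by simp
qed simp

lemma mu_mono: "e \<le> e' \<Longrightarrow> mu K e \<le> mu K e'"
proof (rule lift_Suc_mono_le[of "mu K"])
  fix e
  have "1 * mu K e \<le> real (Suc e) * (4 * mu K e + 2 * (K * mu K e) ^ 2)"
    using mu_ge_1[of K e] by (intro mult_mono) (auto simp: add_increasing2)
  then show "mu K e \<le> mu K (Suc e)" by simp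
qed

section \<open>The thinned process under a deterministic rule\<close>

locale thinning =
  fixes n k :: nat and \<rho> :: rule and thr :: "nat set \<Rightarrow> nat set set \<Rightarrow> real"
  assumes thr_nonneg: "thr W D \<ge> 0"
begin

abbreviation bought :: "nat set list \<Rightarrow> nat \<Rightarrow> nat set set" where
  "bought es r \<equiv> purchased \<rho> es r"

text \<open>
  \<open>alive es (Suc r)\<close> deletes the vertices that are overfull in the graph at time \<open>r\<close>, so the set is
  still determined by the first \<open>r\<close> edges.
\<close>

primrec alive :: "nat set list \<Rightarrow> nat \<Rightarrow> nat set" where
  "alive es 0 = {1..n}"
| "alive es (Suc r) = {v \<in> alive es r. \<forall>(W, D) \<in> small_connected k.
     real (card (copies_at W D (alive es r) (bought es r) v)) \<le> thr W D}"

text \<open>Copies seen at any time up to \<open>T\<close> are kept even if one of their vertices is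
  deleted later, so that a single count accounts for every deletion, whenever it happens.\<close>

definition ever :: "nat set \<Rightarrow> nat set set \<Rightarrow> nat set list \<Rightarrow> nat \<Rightarrow> (nat \<Rightarrow> nat) set" where
  "ever W D es T = (\<Union>r\<le>T. copies W D (alive es r) (bought es r))"

text \<open>A set of candidate maps that does not depend on the order of the edges, so that sums
  over maps and over orders can be exchanged.\<close>

definition embeddings :: "nat set \<Rightarrow> (nat \<Rightarrow> nat) set" where
  "embeddings W = {\<phi> \<in> W \<rightarrow>\<^sub>E {1..n}. inj_on \<phi> W}"

text \<open>With \<open>alive_take\<close> this says that the state at time \<open>r\<close> is a
  function of the first \<open>r\<close> edges. Hence the presence of a given copy is a property of
  a prefix, as the counting lemma for random orders requires.\<close>

lemma bought_take: "r \<le> q \<Longrightarrow> bought (take q es) r = bought es r"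
  unfolding purchased_def by (intro Collect_cong ex_cong1) (auto simp: min_absorb1)

lemma alive_take: "r \<le> q \<Longrightarrow> alive (take q es) r = alive es r"
  by (induction r) (simp_all add: bought_take)

lemma alive_antimono: "r \<le> s \<Longrightarrow> alive es s \<subseteq> alive es r"
  by (rule lift_Suc_antimono_le[of "alive es"]) auto

lemma alive_subset: "alive es r \<subseteq> {1..n}"
  using alive_antimono[of 0 r es] by simp

lemma finite_alive [simp]: "finite (alive es r)"
  by (rule finite_subset[OF alive_subset]) simp

lemma finite_embeddings: "finite W \<Longrightarrow> finite (embeddings W)"
  by (rule finite_subset[of _ "W \<rightarrow>\<^sub>E {1..n}"]) (auto simp: embeddings_def intro: finite_PiE)

lemma copies_alive_subset: "copies W D (alive es r) E \<subseteq> embeddings W"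
proof
  fix \<phi> assume "\<phi> \<in> copies W D (alive es r) E"
  then have "\<phi> \<in> W \<rightarrow>\<^sub>E alive es r" "inj_on \<phi> W" by (auto simp: copies_def)
  then show "\<phi> \<in> embeddings W"
    using PiE_mono[of W "\<lambda>_. alive es r" "\<lambda>_. {1..n}"] alive_subset
    by (auto simp: embeddings_def)
qed

lemma ever_subset: "ever W D es T \<subseteq> embeddings W"
  unfolding ever_def using copies_alive_subset by (rule UN_least)

lemma finite_ever: "finite W \<Longrightarrow> finite (ever W D es T)"
  using finite_subset[OF ever_subset finite_embeddings] .

text \<open>A vertex that survives the check at time \<open>q\<close> meets the threshold among
  \<open>alive es q\<close>, and shrinking the vertex set only loses copies.\<close>

lemma card_copies_at_alive_le:
  assumes "(W, D) \<in> small_connected k" "v \<in> alive es (Suc q)"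
  shows "real (card (copies_at W D (alive es (Suc q)) (bought es q) v)) \<le> thr W D"
proof -
  have "finite W" using assms(1) by (auto simp: small_connected_def connected_graph_def simple_graph_def)
  then have "card (copies_at W D (alive es (Suc q)) (bought es q) v)
      \<le> card (copies_at W D (alive es q) (bought es q) v)"
    by (intro card_mono copies_at_mono alive_antimono) auto
  moreover have "real (card (copies_at W D (alive es q) (bought es q) v)) \<le> thr W D"
    using assms by auto
  ultimately show ?thesis by linarith
qed

text \<open>Choose \<open>f\<close> so that its image arrives last. As \<phi> is injective, the
  other edges have different images and were bought strictly earlier.\<close>

lemma ever_last_edge:
  assumes sg: "simple_graph W D" and ne: "D \<noteq> {}" and \<phi>: "\<phi> \<in> ever W D es T"
  obtains f q where "f \<in> D" "q < T" "q < length es" "\<rho> (take (Suc q) es)" "es ! q = \<phi> ` f"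
    "\<phi> \<in> copies W (D - {f}) (alive es (Suc q)) (bought es q)"
proof -
  have finD: "finite D" and DW: "\<And>e. e \<in> D \<Longrightarrow> e \<subseteq> W"
    using sg simple_graph_finite_edges by (auto simp: simple_graph_def)
  obtain r where r: "r \<le> T" "\<phi> \<in> copies W D (alive es r) (bought es r)"
    using \<phi> by (auto simp: ever_def)
  then have in_r: "\<And>e. e \<in> D \<Longrightarrow> \<phi> ` e \<in> bought es r" and inj: "inj_on \<phi> W"
    and ext: "\<phi> \<in> W \<rightarrow>\<^sub>E alive es r"
    by (auto simp: copies_def)
  have "\<forall>e\<in>D. \<exists>i. i < r \<and> i < length es \<and> \<rho> (take (Suc i) es) \<and> es ! i = \<phi> ` e"
    using in_r unfolding purchased_def by blast
  then obtain i where i: "\<And>e. e \<in> D \<Longrightarrow> i e < r \<and> i e < length es \<and> \<rho> (take (Suc (i e)) es)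
      \<and> es ! i e = \<phi> ` e"
    by metis
  obtain f where f: "f \<in> D" and max: "\<And>e. e \<in> D \<Longrightarrow> i e \<le> i f"
    using Max_in[of "i ` D"] Max_ge[of "i ` D"] finD ne by (smt (verit) finite_imageI image_iff image_is_empty)
  have "\<phi> ` e \<in> bought es (i f)" if e: "e \<in> D - {f}" for e
  proof -
    have "\<phi> ` e \<noteq> \<phi> ` f" using e f DW inj_on_image_eq_iff[OF inj] by auto
    then have "i e \<noteq> i f" using i[of e] i[OF f] e by auto
    then have "i e < i f" using max[of e] e by auto
    then show ?thesis using i[of e] e unfolding purchased_def by auto
  qed
  \<comment> \<open>Deletion is irrevocable and \<open>Suc (i f) \<le> r\<close>, so vertices alive
    at time \<open>r\<close> had already passed the check made just before the last edge
    arrived.\<close>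
  moreover have "\<phi> \<in> W \<rightarrow>\<^sub>E alive es (Suc (i f))"
    using ext PiE_mono[of W "\<lambda>_. alive es r" "\<lambda>_. alive es (Suc (i f))"]
      alive_antimono[of "Suc (i f)" r es] i[OF f] by auto
  ultimately have "\<phi> \<in> copies W (D - {f}) (alive es (Suc (i f))) (bought es (i f))"
    using inj by (auto simp: copies_def)
  then show ?thesis using that[OF f, of "i f"] i[OF f] r(1) by auto
qed

text \<open>The copies completed by the purchase of the image of \<open>f\<close>. Using
  \<open>alive es (Suc q)\<close> with \<open>bought es q\<close> records that the vertices passed
  the check immediately before that purchase.\<close>

definition closing :: "nat set \<Rightarrow> nat set set \<Rightarrow> nat set \<Rightarrow> nat set list \<Rightarrow> nat \<Rightarrow> (nat \<Rightarrow> nat) set" where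
  "closing W D f es T = {\<phi> \<in> embeddings W. \<exists>q<T. q < length es \<and> \<rho> (take (Suc q) es) \<and> es ! q = \<phi> ` f \<and>
     \<phi> \<in> copies W (D - {f}) (alive es (Suc q)) (bought es q)}"

lemma card_ever_le_sum_closing:
  assumes "simple_graph W D" "D \<noteq> {}"
  shows "card (ever W D es T) \<le> (\<Sum>f\<in>D. card (closing W D f es T))"
proof -
  have fin: "finite W" "finite D" using assms(1) simple_graph_finite_edges by (auto simp: simple_graph_def)
  have "ever W D es T \<subseteq> (\<Union>f\<in>D. closing W D f es T)"
  proof
    fix \<phi> assume \<phi>: "\<phi> \<in> ever W D es T"
    from ever_last_edge[OF assms \<phi>] obtain f q where
      fq: "f \<in> D" "q < T" "q < length es" "\<rho> (take (Suc q) es)" "es ! q = \<phi> ` f"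
      "\<phi> \<in> copies W (D - {f}) (alive es (Suc q)) (bought es q)" .
    then have "\<phi> \<in> closing W D f es T"
      unfolding closing_def using ever_subset \<phi> by blast
    then show "\<phi> \<in> (\<Union>f\<in>D. closing W D f es T)" using fq(1) by blast
  qed
  moreover have "finite (closing W D f es T)" for f
    by (rule finite_subset[OF _ finite_embeddings[OF fin(1)]]) (auto simp: closing_def)
  ultimately have "card (ever W D es T) \<le> card (\<Union>f\<in>D. closing W D f es T)"
    using fin by (intro card_mono) auto
  also have "\<dots> \<le> (\<Sum>f\<in>D. card (closing W D f es T))" by (rule card_UN_le[OF fin(2)])
  finally show ?thesis .
qed

text \<open>For a fixed map \<phi> the missing pair \<open>\<phi>\<close> + "\<open>f\<close>" is a
  fixed element of the order, and being a copy of \<open>F - f\<close> is a property of the prefix.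
  The counting lemma for random orders applies to each \<phi>, and double counting sums the result
  over all maps.\<close>

lemma sum_closing_cycle:
  assumes sg: "simple_graph W D" and f: "f \<in> D" and T: "T \<le> n choose 2"
  defines "P \<equiv> permutations_of_set (edges_K n)"
  shows "(\<Sum>es\<in>P. card (closing W D f es T)) * (n choose 2) \<le> T * (\<Sum>es\<in>P. card (ever W (D - {f}) es T))"
proof -
  \<comment> \<open>The time is read off as the length of the prefix, since the stopping condition
    sees nothing but a list.\<close>
  define Q where "Q = (\<lambda>\<phi> xs. \<phi> \<in> copies W (D - {f}) (alive xs (length xs)) (bought xs (length xs)))"
  have finW: "finite W" using sg by (simp add: simple_graph_def)
  have finP: "finite P" by (simp add: P_def)
  have len: "length es = n choose 2" if "es \<in> P" for es
    using that by (simp add: P_def length_finite_permutations_of_set card_edges_K)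
  have Q: "Q \<phi> (take q es) \<longleftrightarrow> \<phi> \<in> copies W (D - {f}) (alive es q) (bought es q)"
    if "es \<in> P" "q \<le> T" for \<phi> q es
    using that T len[OF that(1)] by (simp add: Q_def alive_take bought_take min_absorb2)
  have pre: "card {es \<in> P. \<exists>q<T. es ! q = \<phi> ` f \<and> Q \<phi> (take q es)} * (n choose 2)
      \<le> T * card {es \<in> P. \<exists>q\<le>T. Q \<phi> (take q es)}" if "\<phi> \<in> embeddings W" for \<phi>
  proof -
    have "\<phi> ` f \<in> edges_K n"
    proof -
      have "f \<subseteq> W" "card f = 2" using sg f by (auto simp: simple_graph_def)
      then show ?thesis
        using that card_image[of \<phi> f] inj_on_subset[of \<phi> W f]
        by (auto simp: embeddings_def edges_K_def PiE_def Pi_def)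
    qed
    then show ?thesis
      using card_prefix_then_element_le[OF finite_edges_K, of _ n T] T unfolding P_def card_edges_K
      by blast
  qed
  have "(\<Sum>es\<in>P. card (closing W D f es T))
      \<le> (\<Sum>es\<in>P. card {\<phi> \<in> embeddings W. \<exists>q<T. es ! q = \<phi> ` f \<and> Q \<phi> (take q es)})"
  proof (intro sum_mono card_mono subsetI)
    fix es \<phi> assume es: "es \<in> P" and \<phi>: "\<phi> \<in> closing W D f es T"
    then obtain q where q: "q < T" "es ! q = \<phi> ` f" "\<phi> \<in> embeddings W"
      "\<phi> \<in> copies W (D - {f}) (alive es (Suc q)) (bought es q)" by (auto simp: closing_def)
    moreover have "copies W (D - {f}) (alive es (Suc q)) (bought es q)
        \<subseteq> copies W (D - {f}) (alive es q) (bought es q)"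
      by (intro copies_mono alive_antimono) simp_all
    ultimately have "\<phi> \<in> copies W (D - {f}) (alive es q) (bought es q)" by blast
    then show "\<phi> \<in> {\<phi> \<in> embeddings W. \<exists>q<T. es ! q = \<phi> ` f \<and> Q \<phi> (take q es)}"
      using q Q[OF es, of q] by auto
  qed (simp add: finite_embeddings finW)
  also have "\<dots> = (\<Sum>\<phi>\<in>embeddings W. card {es \<in> P. \<exists>q<T. es ! q = \<phi> ` f \<and> Q \<phi> (take q es)})"
    using finP finite_embeddings[OF finW] by (rule sum_card_swap)
  finally have "(\<Sum>es\<in>P. card (closing W D f es T)) * (n choose 2)
      \<le> (\<Sum>\<phi>\<in>embeddings W. card {es \<in> P. \<exists>q<T. es ! q = \<phi> ` f \<and> Q \<phi> (take q es)}) * (n choose 2)"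
    by (rule mult_le_mono1)
  also have "\<dots> \<le> (\<Sum>\<phi>\<in>embeddings W. T * card {es \<in> P. \<exists>q\<le>T. Q \<phi> (take q es)})"
    unfolding sum_distrib_right by (intro sum_mono pre)
  also have "\<dots> = T * (\<Sum>es\<in>P. card {\<phi> \<in> embeddings W. \<exists>q\<le>T. Q \<phi> (take q es)})"
    unfolding sum_distrib_left[symmetric] using sum_card_swap[OF finP finite_embeddings[OF finW]] by simp
  also have "\<dots> \<le> T * (\<Sum>es\<in>P. card (ever W (D - {f}) es T))"
  proof (intro mult_le_mono2 sum_mono card_mono finite_ever finW subsetI)
    fix es \<phi> assume "es \<in> P" "\<phi> \<in> {\<phi> \<in> embeddings W. \<exists>q\<le>T. Q \<phi> (take q es)}"
    then show "\<phi> \<in> ever W (D - {f}) es T" using Q[of es] by (auto simp: ever_def)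
  qed
  finally show ?thesis .
qed

text \<open>There are at most \<open>b\<close> purchases, and each bought pair can be the image of
  the bridge in two directions. Given the direction, a copy is determined by its restrictions to
  \<open>W1\<close> and \<open>W2\<close>, which are copies at the two end vertices and hence
  limited by the thresholds.\<close>

lemma card_closing_bridge:
  assumes dist: "distinct es" and budget: "card (bought es T) \<le> b"
    and F1: "(W1, D1) \<in> small_connected k" and F2: "(W2, D2) \<in> small_connected k"
    and W: "W = W1 \<union> W2" and f: "f = {x, y}" "x \<in> W1" "y \<in> W2" and D: "D - {f} = D1 \<union> D2"
  shows "real (card (closing W D f es T)) \<le> 2 * real b * thr W1 D1 * thr W2 D2"
proof -
  have fin: "finite W1" "finite W2" and sub: "\<And>e. e \<in> D1 \<Longrightarrow> e \<subseteq> W1" "\<And>e. e \<in> D2 \<Longrightarrow> e \<subseteq> W2"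
    using F1 F2 by (auto simp: small_connected_def connected_graph_def simple_graph_def)
  define I where "I = {q. q < T \<and> q < length es \<and> \<rho> (take (Suc q) es)}"
  define Z where "Z = (\<lambda>q. {\<phi> \<in> copies W (D - {f}) (alive es (Suc q)) (bought es q). es ! q = \<phi> ` f})"
  have finI: "finite I" by (simp add: I_def)
  have finZ: "finite (Z q)" for q using fin by (simp add: Z_def W)
  have "bought es T = (!) es ` I" by (auto simp: purchased_def I_def)
  \<comment> \<open>Since the edges of the order are distinct, purchase times correspond to
    purchased edges, and the budget bounds the number of times.\<close>
  moreover have "inj_on ((!) es) I" using dist by (auto simp: I_def inj_on_def nth_eq_iff_index_eq)
  ultimately have cardI: "card I \<le> b" using budget by (simp add: card_image)
  have restr: "restrict \<phi> W1 \<in> copies_at W1 D1 V E (\<phi> x) \<and> restrict \<phi> W2 \<in> copies_at W2 D2 V E (\<phi> y)"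
    if "\<phi> \<in> copies W (D - {f}) V E" for \<phi> V E
  proof -
    have "\<phi> \<in> W \<rightarrow>\<^sub>E V" "inj_on \<phi> W" and e: "\<And>e. e \<in> D - {f} \<Longrightarrow> \<phi> ` e \<in> E"
      using that by (auto simp: copies_def)
    moreover have "restrict \<phi> W1 ` e = \<phi> ` e" if "e \<in> D1" for e
      using sub(1)[OF that] by (auto intro!: image_cong)
    moreover have "restrict \<phi> W2 ` e = \<phi> ` e" if "e \<in> D2" for e
      using sub(2)[OF that] by (auto intro!: image_cong)
    ultimately show ?thesis
      using f(2,3) D by (auto simp: copies_at_def copies_def W PiE_def inj_on_def)
  qed
  have Z: "real (card (Z q)) \<le> 2 * thr W1 D1 * thr W2 D2" for q
  proof (cases "Z q = {}")
    case True
    then show ?thesis using thr_nonneg by simp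
  next
    case False
    define V where "V = alive es (Suc q)"
    define C1 where "C1 = copies_at W1 D1 V (bought es q)"
    define C2 where "C2 = copies_at W2 D2 V (bought es q)"
    \<comment> \<open>Any one copy reveals that the pair presented at time \<open>q\<close> consists
      of two vertices that passed the check, so the thresholds hold at both.\<close>
    obtain \<phi>0 where \<phi>0: "\<phi>0 \<in> Z q" using False by auto
    define u w where "u = \<phi>0 x" and "w = \<phi>0 y"
    have uw: "es ! q = {u, w}" "u \<in> V" "w \<in> V"
      using \<phi>0 f by (auto simp: Z_def u_def w_def copies_def W V_def)
    have C1: "real (card (C1 v)) \<le> thr W1 D1" and C2: "real (card (C2 v)) \<le> thr W2 D2" if "v \<in> V" for v
      using card_copies_at_alive_le[OF F1] card_copies_at_alive_le[OF F2] that
      unfolding C1_def C2_def V_def by blast+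
    have finC: "finite (C1 v)" "finite (C2 v)" for v using fin by (auto simp: C1_def C2_def V_def)
    have inj: "inj_on (\<lambda>\<phi>. (restrict \<phi> W1, restrict \<phi> W2)) (Z q)"
    proof (rule inj_onI)
      fix \<phi> \<psi> assume a: "\<phi> \<in> Z q" "\<psi> \<in> Z q"
        "(restrict \<phi> W1, restrict \<phi> W2) = (restrict \<psi> W1, restrict \<psi> W2)"
      then have "\<phi> \<in> extensional W" "\<psi> \<in> extensional W" by (auto simp: Z_def copies_def PiE_def)
      moreover have "\<phi> z = \<psi> z" if "z \<in> W" for z
        using a(3) that unfolding W prod.inject by (metis UnE restrict_apply')
      ultimately show "\<phi> = \<psi>" by (rule extensionalityI)
    qed
    have "(restrict \<phi> W1, restrict \<phi> W2) \<in> C1 u \<times> C2 w \<union> C1 w \<times> C2 u" if "\<phi> \<in> Z q" for \<phi>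
    proof -
      have "{\<phi> x, \<phi> y} = {u, w}" using that uw f by (simp add: Z_def)
      then have "\<phi> x = u \<and> \<phi> y = w \<or> \<phi> x = w \<and> \<phi> y = u" by (simp add: doubleton_eq_iff)
      moreover have "restrict \<phi> W1 \<in> C1 (\<phi> x)" "restrict \<phi> W2 \<in> C2 (\<phi> y)"
        using restr that by (auto simp: Z_def C1_def C2_def V_def)
      ultimately show ?thesis by auto
    qed
    then have "card (Z q) \<le> card (C1 u \<times> C2 w \<union> C1 w \<times> C2 u)"
      using finC by (intro card_inj_on_le[OF inj]) auto
    also have "\<dots> \<le> card (C1 u) * card (C2 w) + card (C1 w) * card (C2 u)"
      using card_Un_le by (metis card_cartesian_product)
    finally have "real (card (Z q)) \<le> real (card (C1 u)) * real (card (C2 w)) + real (card (C1 w)) * real (card (C2 u))"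
      by (metis of_nat_add of_nat_le_iff of_nat_mult)
    also have "\<dots> \<le> thr W1 D1 * thr W2 D2 + thr W1 D1 * thr W2 D2"
      using C1 C2 uw thr_nonneg by (intro add_mono mult_mono) auto
    finally show ?thesis by simp
  qed
  have "card (closing W D f es T) \<le> card (\<Union>q\<in>I. Z q)"
    using finI finZ by (intro card_mono) (auto simp: closing_def I_def Z_def)
  also have "\<dots> \<le> (\<Sum>q\<in>I. card (Z q))" by (rule card_UN_le[OF finI])
  finally have "real (card (closing W D f es T)) \<le> (\<Sum>q\<in>I. real (card (Z q)))"
    by (metis of_nat_le_iff of_nat_sum)
  also have "\<dots> \<le> (\<Sum>q\<in>I. 2 * thr W1 D1 * thr W2 D2)" by (intro sum_mono Z)
  also have "\<dots> = real (card I) * (2 * thr W1 D1 * thr W2 D2)" by simp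
  also have "\<dots> \<le> real b * (2 * thr W1 D1 * thr W2 D2)"
    using cardI thr_nonneg by (intro mult_right_mono) auto
  finally show ?thesis by (simp add: mult_ac)
qed

text \<open>A vertex deleted by a check at some time \<open>r \<le> T\<close> was overfull for some
  graph of the family, and the copies responsible all lie in \<open>ever\<close>.\<close>

lemma sum_removed:
  "n - card (alive es (Suc T)) \<le> (\<Sum>(W, D) \<in> small_connected k.
     card {v \<in> {1..n}. thr W D < real (card {\<phi> \<in> ever W D es T. v \<in> \<phi> ` W})})"
proof -
  let ?R = "\<lambda>(W, D). {v \<in> {1..n}. thr W D < real (card {\<phi> \<in> ever W D es T. v \<in> \<phi> ` W})}"
  have "v \<in> (\<Union>F\<in>small_connected k. ?R F)" if "r \<le> Suc T" "v \<in> {1..n}" "v \<notin> alive es r" for v r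
    using that
  proof (induction r)
    case (Suc r)
    show ?case
    proof (cases "v \<in> alive es r")
      case True
      then obtain W D where F: "(W, D) \<in> small_connected k"
        and big: "thr W D < real (card (copies_at W D (alive es r) (bought es r) v))"
        using Suc.prems by (auto simp: not_le)
      have "finite W" using F by (auto simp: small_connected_def connected_graph_def simple_graph_def)
      then have "card (copies_at W D (alive es r) (bought es r) v) \<le> card {\<phi> \<in> ever W D es T. v \<in> \<phi> ` W}"
        using Suc.prems finite_ever by (intro card_mono) (auto simp: copies_at_def ever_def)
      then have "v \<in> ?R (W, D)" using big Suc.prems(2) by auto
      then show ?thesis using F by blast
    qed (use Suc in auto)
  qed simp
  then have "{1..n} - alive es (Suc T) \<subseteq> (\<Union>F\<in>small_connected k. ?R F)" by blast
  then have "card ({1..n} - alive es (Suc T)) \<le> card (\<Union>F\<in>small_connected k. ?R F)"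
    by (rule card_mono[rotated]) (auto simp: finite_small_connected)
  also have "\<dots> \<le> (\<Sum>F\<in>small_connected k. card (?R F))" by (rule card_UN_le[OF finite_small_connected])
  also have "card ({1..n} - alive es (Suc T)) = n - card (alive es (Suc T))"
    by (subst card_Diff_subset[OF finite_alive alive_subset]) simp
  finally show ?thesis by (simp add: case_prod_unfold)
qed

text \<open>Double counting of pairs of a copy and one of its vertices: each copy covers at most
  \<open>k\<close> vertices, while each overfull vertex lies in more than \<open>thr W D\<close>
  copies.\<close>

lemma card_overfull_le:
  assumes "(W, D) \<in> small_connected k"
  shows "thr W D * real (card {v \<in> {1..n}. thr W D < real (card {\<phi> \<in> ever W D es T. v \<in> \<phi> ` W})})
    \<le> real k * real (card (ever W D es T))"
proof -
  let ?c = "\<lambda>v. card {\<phi> \<in> ever W D es T. v \<in> \<phi> ` W}"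
  let ?R = "{v \<in> {1..n}. thr W D < real (?c v)}"
  have fin: "finite W" and Wk: "W \<subseteq> {..<k}"
    using assms by (auto simp: small_connected_def connected_graph_def simple_graph_def)
  have "real (card ?R) * thr W D \<le> (\<Sum>v\<in>?R. real (?c v))"
    by (rule sum_bounded_below) simp
  also have "\<dots> \<le> (\<Sum>v\<in>{1..n}. real (?c v))" by (intro sum_mono2) auto
  also have "\<dots> = real (\<Sum>\<phi>\<in>ever W D es T. card {v \<in> {1..n}. v \<in> \<phi> ` W})"
    unfolding of_nat_sum[symmetric]
    by (rule arg_cong[of _ _ real], rule sum_card_swap) (simp_all add: finite_ever fin)
  also have "\<dots> \<le> real (\<Sum>\<phi>\<in>ever W D es T. k)"
  proof (intro of_nat_mono sum_mono)
    fix \<phi>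
    have "card {v \<in> {1..n}. v \<in> \<phi> ` W} \<le> card (\<phi> ` W)" using fin by (intro card_mono) auto
    also have "\<dots> \<le> card W" using fin by (rule card_image_le)
    also have "\<dots> \<le> k" using Wk by (metis card_lessThan card_mono finite_lessThan)
    finally show "card {v \<in> {1..n}. v \<in> \<phi> ` W} \<le> k" .
  qed
  finally show ?thesis by (simp add: mult_ac)
qed

end

lemma connected_no_edges: "connected_graph W {} \<Longrightarrow> card W = 1"
proof -
  assume con: "connected_graph W {}"
  then obtain x where x: "x \<in> W" by (auto simp: connected_graph_def)
  have "reach {} x \<subseteq> {x}" by (auto simp: reach_def)
  then have "W = {x}" using con x unfolding connected_graph_reach by blast
  then show ?thesis by simp
qed

text \<open>The source of the factor 4 in \<open>mu\<close>: it converts the probability bound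
  \<open>T / (n choose 2)\<close> of the cycle case into the \<open>T / n^2\<close> of the
  weight.\<close>

lemma square_le_four_choose_two:
  assumes "n \<ge> 2" shows "real n ^ 2 \<le> 4 * real (n choose 2)"
proof -
  have "real (n choose 2) = real n * (real n - 1) / 2"
    using assms by (simp add: choose_two real_of_nat_div of_nat_diff)
  moreover have "real n * 2 \<le> real n * real n" using assms by (intro mult_left_mono) auto
  ultimately show ?thesis by (simp add: power2_eq_square algebra_simps)
qed

subsection \<open>Expected number of copies\<close>

locale weighted_thinning =
  fixes n k T b :: nat and \<rho> :: rule and K :: real
  assumes n: "n \<ge> 2" and T: "T \<in> {1..n choose 2}" and b: "b \<ge> 1" and K: "K \<ge> 1"
    and budget: "\<And>es. es \<in> permutations_of_set (edges_K n) \<Longrightarrow> card (purchased \<rho> es T) \<le> b"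
begin

abbreviation "w \<equiv> weight n T b"

text \<open>The expected number of copies will be at most
  \<open>mu K (card D) * n * w (card W) (card D)\<close>, so the threshold is \<open>K\<close> times
  the resulting average per vertex of \<open>{1..n}\<close>.\<close>

definition thr :: "nat set \<Rightarrow> nat set set \<Rightarrow> real" where
  "thr W D = K * mu K (card D) * w (card W) (card D)"

lemma w_pos: "w v e > 0"
  using n T b by (intro weight_pos) auto

lemma thr_pos: "thr W D > 0"
  using mu_ge_1[of K "card D"] K w_pos by (simp add: thr_def)

sublocale thinning n k \<rho> thr
  by unfold_locales (rule less_imp_le[OF thr_pos])

text \<open>Expectations appear as sums over \<open>orders\<close>; the division by \<open>N\<close>
  is postponed to the final probability.\<close>

definition "orders = permutations_of_set (edges_K n)"

definition "N = card orders"

lemma finite_orders: "finite orders"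
  by (simp add: orders_def)

lemma N_pos: "N > 0"
  by (simp add: N_def orders_def)

text \<open>Induction on the number of edges, split by the last edge \<open>f\<close> of a copy. If
  \<open>F - f\<close> is connected, the induction hypothesis bounds its copies. At a bridge the
  deletion thresholds take over: they bound the copies at both ends for every order, which avoids
  any estimate of the dependence between the two components.\<close>

lemma sum_ever_le:
  assumes "(W, D) \<in> small_connected k"
  shows "real (\<Sum>es\<in>orders. card (ever W D es T)) \<le> mu K (card D) * real n * w (card W) (card D) * real N"
  using assms
proof (induction "card D" arbitrary: W D)
  case 0
  then have sg: "simple_graph W D" and con: "connected_graph W D"
    by (auto simp: small_connected_def connected_graph_def)
  have D: "D = {}" using 0 simple_graph_finite_edges[OF sg] by simp
  then have W: "card W = 1" using con connected_no_edges by simp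
  have fin: "finite W" using sg by (simp add: simple_graph_def)
  \<comment> \<open>A single vertex has weight 1 and \<open>mu K 0 = 1\<close>, so the claim reduces
    to the bound \<open>n\<close> for each order.\<close>
  have "card (ever W D es T) \<le> n" for es
  proof -
    have "card (ever W D es T) \<le> card (W \<rightarrow>\<^sub>E {1..n})"
      using ever_subset[of W D es T] fin
      by (intro card_mono finite_PiE) (auto simp: embeddings_def)
    then show ?thesis using W fin by (simp add: card_PiE)
  qed
  then have "real (\<Sum>es\<in>orders. card (ever W D es T)) \<le> real (\<Sum>es\<in>orders. n)"
    by (intro of_nat_mono sum_mono)
  then show ?case using D W by (simp add: weight_def N_def mult.commute)
next
  case (Suc e)
  have con: "connected_graph W D" and Wk: "W \<subseteq> {..<k}" using Suc.prems by (auto simp: small_connected_def)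
  then have sg: "simple_graph W D" by (simp add: connected_graph_def)
  then have finD: "finite D" by (rule simple_graph_finite_edges)
  define v where "v = card W"
  define c where "c = real n * w v (Suc e) * real N"
  have c0: "c \<ge> 0" using w_pos[of v "Suc e"] by (simp add: c_def)
  \<comment> \<open>The bracket adds the bounds of both cases, so it serves for every
    \<open>f\<close>; summing over the \<open>Suc e\<close> edges gives
    \<open>mu K (Suc e)\<close>.\<close>
  have bound: "real (\<Sum>es\<in>orders. card (closing W D f es T)) \<le> (4 * mu K e + 2 * (K * mu K e) ^ 2) * c"
    if f: "f \<in> D" for f
    using con f
  proof (cases rule: connected_remove_edge)
    case cycle
    have card: "card (D - {f}) = e" using f finD Suc.hyps(2) by simp
    have IH: "real (\<Sum>es\<in>orders. card (ever W (D - {f}) es T)) \<le> mu K e * real n * w v e * real N"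
      using Suc.hyps(1)[of "D - {f}" W] cycle Wk card by (simp add: small_connected_def v_def)
    let ?S = "real (\<Sum>es\<in>orders. card (closing W D f es T))"
    have "?S * real (n choose 2) \<le> real T * real (\<Sum>es\<in>orders. card (ever W (D - {f}) es T))"
      using sum_closing_cycle[OF sg f, of T] T unfolding orders_def by (metis atLeastAtMost_iff of_nat_le_iff of_nat_mult)
    also have "\<dots> \<le> real T * (mu K e * real n * w v e * real N)" by (rule mult_left_mono[OF IH]) simp
    finally have 1: "?S * real (n choose 2) \<le> mu K e * real n * real N * (w v e * real T)"
      by (simp add: mult_ac)
    have "?S * real n ^ 2 \<le> ?S * (4 * real (n choose 2))"
      by (intro mult_left_mono square_le_four_choose_two n of_nat_0_le_iff)
    also have "\<dots> \<le> 4 * (mu K e * real n * real N * (w v e * real T))" using 1 by simp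
    also have "w v e * real T = w v (Suc e) * real n ^ 2"
      using n T by (intro weight_add_edge[symmetric]) auto
    finally have "?S * real n ^ 2 \<le> (4 * mu K e * c) * real n ^ 2" by (simp add: c_def mult_ac)
    then have "?S \<le> 4 * mu K e * c" using n by simp
    also have "\<dots> \<le> (4 * mu K e + 2 * (K * mu K e) ^ 2) * c"
      using c0 by (intro mult_right_mono) auto
    finally show ?thesis .
  next
    case (bridge x y W1 D1 W2 D2)
    have F: "(W1, D1) \<in> small_connected k" "(W2, D2) \<in> small_connected k"
      using bridge(4-6) Wk by (simp_all add: small_connected_def)
    have "simple_graph W1 D1" "simple_graph W2 D2"
      using bridge(4,5) by (simp_all only: connected_graph_def)
    then have fin: "finite W1" "finite W2" "finite D1" "finite D2"
      using simple_graph_finite_edges by (simp_all only: simple_graph_def)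
    have v: "v = card W1 + card W2" using bridge(6,7) fin by (simp add: v_def card_Un_disjoint)
    have e: "e = card D1 + card D2"
    proof -
      have "card D1 + card D2 = card (D - {f})"
        using bridge(8,9) fin by (simp only: card_Un_disjoint)
      then show ?thesis using f finD Suc.hyps(2)[symmetric] by simp
    qed
    have mu: "mu K (card D1) \<le> mu K e" "mu K (card D2) \<le> mu K e" using e by (simp_all add: mu_mono)
    have "real b * thr W1 D1 * thr W2 D2
        = (K * mu K (card D1)) * (K * mu K (card D2)) * (real b * w (card W1) (card D1) * w (card W2) (card D2))"
      by (simp add: thr_def mult_ac)
    also have "\<dots> = (K * mu K (card D1)) * (K * mu K (card D2)) * (real n * w v (Suc e))"
      using n T b by (subst weight_join) (auto simp: v e)
    also have "\<dots> \<le> (K * mu K e) * (K * mu K e) * (real n * w v (Suc e))"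
      using mu K order_trans[OF zero_le_one mu_ge_1] less_imp_le[OF w_pos[of v "Suc e"]]
      by (intro mult_right_mono mult_mono) simp_all
    finally have thr: "real b * thr W1 D1 * thr W2 D2 \<le> (K * mu K e) ^ 2 * (real n * w v (Suc e))"
      by (simp add: power2_eq_square)
    have "real (card (closing W D f es T)) \<le> 2 * (K * mu K e) ^ 2 * (real n * w v (Suc e))"
      if "es \<in> orders" for es
    proof -
      have "distinct es" "card (bought es T) \<le> b"
        using that budget permutations_of_setD(2) unfolding orders_def by blast+
      then have "real (card (closing W D f es T)) \<le> 2 * real b * thr W1 D1 * thr W2 D2"
        by (rule card_closing_bridge[OF _ _ F bridge(6) bridge(1-3) bridge(8)])
      then show ?thesis using thr by (simp add: mult.assoc)
    qed
    then have "real (\<Sum>es\<in>orders. card (closing W D f es T))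
        \<le> (\<Sum>es\<in>orders. 2 * (K * mu K e) ^ 2 * (real n * w v (Suc e)))"
      unfolding of_nat_sum by (intro sum_mono)
    also have "\<dots> = 2 * (K * mu K e) ^ 2 * c" by (simp add: c_def N_def mult_ac)
    also have "\<dots> \<le> (4 * mu K e + 2 * (K * mu K e) ^ 2) * c"
      using c0 mu_ge_1[of K e] by (intro mult_right_mono) auto
    finally show ?thesis .
  qed
  have "(\<Sum>es\<in>orders. card (ever W D es T)) \<le> (\<Sum>es\<in>orders. \<Sum>f\<in>D. card (closing W D f es T))"
    using Suc.hyps(2) by (intro sum_mono card_ever_le_sum_closing sg) auto
  then have "real (\<Sum>es\<in>orders. card (ever W D es T)) \<le> (\<Sum>f\<in>D. real (\<Sum>es\<in>orders. card (closing W D f es T)))"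
    by (subst (asm) sum.swap) (metis of_nat_le_iff of_nat_sum)
  also have "\<dots> \<le> (\<Sum>f\<in>D. (4 * mu K e + 2 * (K * mu K e) ^ 2) * c)" by (intro sum_mono bound)
  also have "\<dots> = mu K (Suc e) * c" using Suc.hyps(2)[symmetric] by simp
  finally show ?case using Suc.hyps(2)[symmetric] by (simp only: c_def v_def mult.assoc)
qed

text \<open>For each graph of the family the threshold is \<open>K * m\<close> and the mean number
  of copies is at most \<open>m * n\<close>. The common factor \<open>m\<close> cancels, leaving at
  most \<open>k * n / K\<close> overfull vertices on average.\<close>

lemma sum_removed_le:
  "K * real (\<Sum>es\<in>orders. n - card (alive es (Suc T))) \<le> real (card (small_connected k)) * real k * real n * real N"
proof -
  define R where "R = (\<lambda>W D es. card {v \<in> {1..n}. thr W D < real (card {\<phi> \<in> ever W D es T. v \<in> \<phi> ` W})})"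
  have R: "K * real (\<Sum>es\<in>orders. R W D es) \<le> real k * real n * real N"
    if F: "(W, D) \<in> small_connected k" for W D
  proof -
    define m where "m = mu K (card D) * w (card W) (card D)"
    have m: "m > 0" using mu_ge_1[of K "card D"] w_pos by (simp add: m_def)
    have thr: "thr W D = K * m" by (simp add: thr_def m_def)
    have "m * (K * real (\<Sum>es\<in>orders. R W D es)) = (\<Sum>es\<in>orders. thr W D * real (R W D es))"
      by (simp add: thr sum_distrib_left mult_ac)
    also have "\<dots> \<le> (\<Sum>es\<in>orders. real k * real (card (ever W D es T)))"
      unfolding R_def by (intro sum_mono card_overfull_le F)
    also have "\<dots> = real k * real (\<Sum>es\<in>orders. card (ever W D es T))" by (simp add: sum_distrib_left)
    also have "\<dots> \<le> real k * (mu K (card D) * real n * w (card W) (card D) * real N)"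
      by (intro mult_left_mono sum_ever_le F) simp
    also have "\<dots> = m * (real k * real n * real N)" by (simp add: m_def mult_ac)
    finally show ?thesis using m by simp
  qed
  have "(\<Sum>es\<in>orders. n - card (alive es (Suc T))) \<le> (\<Sum>es\<in>orders. \<Sum>(W, D)\<in>small_connected k. R W D es)"
    unfolding R_def by (intro sum_mono sum_removed)
  also have "\<dots> = (\<Sum>F\<in>small_connected k. \<Sum>es\<in>orders. R (fst F) (snd F) es)"
    by (subst sum.swap) (simp add: case_prod_unfold)
  finally have "K * real (\<Sum>es\<in>orders. n - card (alive es (Suc T)))
      \<le> K * real (\<Sum>F\<in>small_connected k. \<Sum>es\<in>orders. R (fst F) (snd F) es)"
    using K by (intro mult_left_mono of_nat_mono) auto
  also have "\<dots> = (\<Sum>F\<in>small_connected k. K * real (\<Sum>es\<in>orders. R (fst F) (snd F) es))"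
    by (simp add: sum_distrib_left)
  also have "\<dots> \<le> (\<Sum>F\<in>small_connected k. real k * real n * real N)"
    by (intro sum_mono R) simp
  finally show ?thesis by simp
qed

text \<open>Markov's inequality: a bad order loses at least \<epsilon> n vertices, whereas the
  average loss is at most \<epsilon>^2 n by the choice of \<open>K\<close>.\<close>

lemma card_few_alive_le:
  assumes \<epsilon>: "\<epsilon> > 0" and large: "real (card (small_connected k)) * real k \<le> \<epsilon> ^ 2 * K"
  shows "real (card {es \<in> orders. real (card (alive es (Suc T))) < (1 - \<epsilon>) * real n}) \<le> \<epsilon> * real N"
proof -
  let ?Bad = "{es \<in> orders. real (card (alive es (Suc T))) < (1 - \<epsilon>) * real n}"
  let ?r = "\<lambda>es. real (n - card (alive es (Suc T)))"
  have n0: "real n > 0" using n by simp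
  have "real (card ?Bad) * (\<epsilon> * real n) \<le> (\<Sum>es\<in>?Bad. ?r es)"
  proof (rule sum_bounded_below)
    fix es assume es: "es \<in> ?Bad"
    have "card (alive es (Suc T)) \<le> n"
      using card_mono[OF _ alive_subset, of es "Suc T"] by simp
    then show "\<epsilon> * real n \<le> ?r es" using es by (simp add: of_nat_diff algebra_simps del: alive.simps)
  qed
  also have "\<dots> \<le> (\<Sum>es\<in>orders. ?r es)"
    using finite_orders by (intro sum_mono2) (auto simp del: alive.simps)
  finally have "K * (real (card ?Bad) * (\<epsilon> * real n)) \<le> K * real (\<Sum>es\<in>orders. n - card (alive es (Suc T)))"
    using K by (simp del: alive.simps)
  also have "\<dots> \<le> (real (card (small_connected k)) * real k) * (real n * real N)"
    using sum_removed_le by (simp add: mult_ac del: alive.simps)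
  also have "\<dots> \<le> (\<epsilon> ^ 2 * K) * (real n * real N)" by (intro mult_right_mono large) simp
  finally have "(K * \<epsilon> * real n) * real (card ?Bad) \<le> (K * \<epsilon> * real n) * (\<epsilon> * real N)"
    by (simp add: power2_eq_square mult_ac)
  moreover have "K * \<epsilon> * real n > 0" using K \<epsilon> n0 by simp
  ultimately show ?thesis by (simp only: mult_le_cancel_left_pos)
qed

text \<open>Monotonicity of \<open>mu\<close> and \<open>card D \<le> 2 ^ k\<close> make the
  constant uniform over all graphs of the family.\<close>

lemma copies_at_alive_le:
  assumes "(W, D) \<in> small_connected k" "v \<in> alive es (Suc T)"
  shows "real (card (copies_at W D (alive es (Suc T)) (bought es T) v)) \<le> K * mu K (2 ^ k) * w (card W) (card D)"
proof -
  have sg: "simple_graph W D" and "W \<subseteq> {..<k}"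
    using assms(1) by (auto simp: small_connected_def connected_graph_def)
  then have "card W \<le> k" by (metis card_lessThan card_mono finite_lessThan)
  then have "card D \<le> 2 ^ k"
    using simple_graph_card_edges_le[OF sg] by (meson le_trans one_le_numeral power_increasing)
  then have "K * mu K (card D) * w (card W) (card D) \<le> K * mu K (2 ^ k) * w (card W) (card D)"
    using K w_pos[of "card W" "card D"] by (intro mult_right_mono mult_left_mono mu_mono) auto
  then show ?thesis using card_copies_at_alive_le[OF assms] unfolding thr_def by linarith
qed

end

subsection \<open>The theorem\<close>

text \<open>The theorem ranges over graphs on arbitrary finite sets of naturals, the thinning only
  over subsets of \<open>{..<k}\<close>. Composing copies with the inverse of a bijection from
  \<open>W\<close> to \<open>{..<card W}\<close> maps them injectively to copies of the relabelled
  graph, with the same image.\<close>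

lemma relabel_small_connected:
  fixes W :: "nat set"
  assumes con: "connected_graph W D" and k: "card W \<le> k"
  obtains W' D' where "(W', D') \<in> small_connected k" "card W' = card W" "card D' = card D"
    "\<And>(V :: 'b set) E v. finite V \<Longrightarrow> card (copies_at W D V E v) \<le> card (copies_at W' D' V E v)"
proof -
  have sg: "simple_graph W D" and ne: "W \<noteq> {}" using con by (auto simp: connected_graph_def)
  have fin: "finite W" and sub: "\<And>e. e \<in> D \<Longrightarrow> e \<subseteq> W" "\<And>e. e \<in> D \<Longrightarrow> card e = 2"
    using sg by (auto simp: simple_graph_def)
  define W' where "W' = {..<card W}"
  obtain h where h: "bij_betw h W W'"
    using ex_bij_betw_finite_nat[OF fin] by (auto simp: W'_def atLeast0LessThan)
  then have inj: "inj_on h W" and im: "h ` W = W'" by (auto simp: bij_betw_def)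
  define g where "g = inv_into W h"
  have g: "bij_betw g W' W" using bij_betw_inv_into[OF h] by (simp add: g_def)
  have gh: "g (h x) = x" if "x \<in> W" for x using that inj by (simp add: g_def)
  define D' where "D' = (`) h ` D"
  have injD: "inj_on ((`) h) D"
    using inj_on_image_Pow[OF inj] sub(1) by (auto intro: inj_on_subset)
  have "simple_graph W' D'"
    unfolding simple_graph_def
  proof (intro conjI ballI)
    show "finite W'" by (simp add: W'_def)
    fix e assume "e \<in> D'"
    then obtain d where d: "d \<in> D" "e = h ` d" by (auto simp: D'_def)
    show "e \<subseteq> W'" using sub(1)[OF d(1)] im d(2) by blast
    show "card e = 2" using d sub inj by (simp add: card_image inj_on_subset)
  qed
  moreover have "h z \<in> reach D' (h x)" if "z \<in> reach D x" for x z
    using that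
  proof (induction rule: reach_induct)
    case (step z u)
    have "h ` {z, u} \<in> D'" using step(2) unfolding D'_def by (rule imageI)
    then have "{h z, h u} \<in> D'" by simp
    then show ?case using step.IH reach_step[of "h z" D' "h x" "h u"] by simp
  qed (rule reach_refl)
  then have "\<forall>x\<in>W'. W' \<subseteq> reach D' x"
    using con im[symmetric] unfolding connected_graph_reach by blast
  moreover have "W' \<noteq> {}" using ne im by auto
  ultimately have con': "connected_graph W' D'" by (simp add: connected_graph_reach)
  show thesis
  proof (rule that)
    show "(W', D') \<in> small_connected k" using con' k by (auto simp: small_connected_def W'_def)
    show "card W' = card W" by (simp add: W'_def)
    show "card D' = card D" using injD by (simp add: D'_def card_image)
    fix V :: "'b set" and E v assume V: "finite V"
    let ?\<Theta> = "\<lambda>\<phi>. restrict (\<phi> \<circ> g) W'"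
    have "?\<Theta> ` copies_at W D V E v \<subseteq> copies_at W' D' V E v"
    proof
      fix \<psi> assume "\<psi> \<in> ?\<Theta> ` copies_at W D V E v"
      then obtain \<phi> where \<psi>: "\<psi> = ?\<Theta> \<phi>" and \<phi>: "\<phi> \<in> W \<rightarrow>\<^sub>E V" "inj_on \<phi> W"
        "\<And>e. e \<in> D \<Longrightarrow> \<phi> ` e \<in> E" "v \<in> \<phi> ` W"
        by (auto simp: copies_at_def copies_def)
      have gW: "g ` W' = W" "inj_on g W'" using g by (auto simp: bij_betw_def)
      have "\<psi> ` W' = \<phi> ` W" unfolding gW(1)[symmetric] by (auto simp: \<psi>)
      moreover have "inj_on \<psi> W'"
        unfolding \<psi> inj_on_restrict_eq using gW \<phi>(2) by (simp add: comp_inj_on)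
      moreover have "\<psi> ` e \<in> E" if "e \<in> D'" for e
      proof -
        obtain d where d: "d \<in> D" "e = h ` d" using \<open>e \<in> D'\<close> by (auto simp: D'_def)
        have "\<psi> (h x) = \<phi> x" if "x \<in> d" for x
        proof -
          have "x \<in> W" using that sub(1)[OF d(1)] by blast
          moreover from this have "h x \<in> W'" using im by blast
          ultimately show ?thesis by (simp add: \<psi> gh)
        qed
        then have "\<psi> ` e = \<phi> ` d" unfolding d(2) image_image by (rule image_cong[OF refl])
        then show ?thesis using \<phi>(3) d by simp
      qed
      moreover have "\<psi> \<in> W' \<rightarrow>\<^sub>E V" using \<phi>(1) gW(1) by (auto simp: \<psi>)
      ultimately show "\<psi> \<in> copies_at W' D' V E v" using \<phi>(4) by (simp add: copies_at_def copies_def)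
    qed
    moreover have "inj_on ?\<Theta> (copies_at W D V E v)"
    proof (rule inj_onI)
      fix \<phi> \<psi> assume a: "\<phi> \<in> copies_at W D V E v" "\<psi> \<in> copies_at W D V E v" "?\<Theta> \<phi> = ?\<Theta> \<psi>"
      then have "\<phi> \<in> extensional W" "\<psi> \<in> extensional W" by (auto simp: copies_at_def copies_def PiE_def)
      moreover have "\<phi> x = \<psi> x" if "x \<in> W" for x
        using fun_cong[OF a(3), of "h x"] that im gh by auto
      ultimately show "\<phi> = \<psi>" by (rule extensionalityI)
    qed
    ultimately show "card (copies_at W D V E v) \<le> card (copies_at W' D' V E v)"
      using V by (intro card_inj_on_le[of ?\<Theta>]) (auto simp: W'_def)
  qed
qed

text \<open>Used to condition on the seed: a bound valid for each deterministic rule passes to the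
  mixture.\<close>

lemma prob_bind_pmf_ge:
  assumes "\<And>x. x \<in> set_pmf p \<Longrightarrow> measure_pmf.prob (f x) A \<ge> c"
  shows "measure_pmf.prob (bind_pmf p f) A \<ge> c"
proof -
  have "ennreal c = (\<integral>\<^sup>+x. ennreal c \<partial>measure_pmf p)" by simp
  also have "\<dots> \<le> (\<integral>\<^sup>+x. emeasure (measure_pmf (f x)) A \<partial>measure_pmf p)"
    using assms by (intro nn_integral_mono_AE)
      (auto simp: AE_measure_pmf_iff measure_pmf.emeasure_eq_measure ennreal_leI)
  also have "\<dots> = emeasure (measure_pmf (bind_pmf p f)) A" by (simp add: emeasure_bind_pmf)
  finally show ?thesis by (simp add: measure_pmf.emeasure_eq_measure)
qed

lemma built_graph_bind:
  "built_graph n t S = bind_pmf S (\<lambda>f. map_pmf (\<lambda>es. purchased f es t)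
     (pmf_of_set (permutations_of_set (edges_K n))))"
  by (simp add: built_graph_def pair_pmf_def map_bind_pmf map_pmf_def bind_assoc_pmf bind_return_pmf)

theorem theorem4p1:
  fixes t b :: "nat \<Rightarrow> nat" and k0 :: nat and \<epsilon> :: real
  assumes t_range: "\<And>n. n \<ge> 2 \<Longrightarrow> t n \<in> {1..n choose 2}"
    and b_range: "\<And>n. n \<ge> 2 \<Longrightarrow> b n \<in> {1..n choose 2}"
    and t_small: "(\<lambda>n. real (t n)) \<in> o(\<lambda>n. real n ^ 2)"
    and eps: "\<epsilon> > 0"
  shows "\<exists>lam>0. \<exists>n0. \<forall>n\<ge>n0. \<forall>S. is_strategy n (t n) (b n) S \<longrightarrow>
    measure_pmf.prob (built_graph n (t n) S)
      {B. \<exists>V\<subseteq>{1..n}. real (card V) \<ge> (1 - \<epsilon>) * real n \<and>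
        (\<forall>(W::nat set) D. connected_graph W D \<and> card W \<le> k0 \<longrightarrow>
          (\<forall>v\<in>V. real (card (copies_at W D V (induced_edges B V) v))
             \<le> lam * real (b n) powi (int (card W) - 1)
                   * real (t n) powi (int (card D) - int (card W) + 1)
                   * real n powi (int (card W) - 2 * int (card D) - 1)))}
      \<ge> 1 - \<epsilon>"
proof -
  \<comment> \<open>The quotient makes the average number of deleted vertices at most \<epsilon>^2
    n; the summand 1 ensures \<open>K \<ge> 1\<close> even if the quotient is 0.\<close>
  define K where "K = 1 + real (card (small_connected k0)) * real k0 / \<epsilon> ^ 2"
  define lam where "lam = K * mu K (2 ^ k0)"
  have K: "K \<ge> 1" by (simp add: K_def)
  have large: "real (card (small_connected k0)) * real k0 \<le> \<epsilon> ^ 2 * K"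
    using eps by (simp add: K_def algebra_simps)
  have lam: "lam > 0" using K mu_ge_1[of K "2 ^ k0"] by (simp add: lam_def)
  show ?thesis
  proof (intro exI[of _ lam] conjI lam exI[of _ 2] allI impI)
    fix n S assume n: "n \<ge> 2" and S: "is_strategy n (t n) (b n) S"
    let ?G = "{B. \<exists>V\<subseteq>{1..n}. real (card V) \<ge> (1 - \<epsilon>) * real n \<and>
        (\<forall>(W::nat set) D. connected_graph W D \<and> card W \<le> k0 \<longrightarrow>
          (\<forall>v\<in>V. real (card (copies_at W D V (induced_edges B V) v))
             \<le> lam * real (b n) powi (int (card W) - 1)
                   * real (t n) powi (int (card D) - int (card W) + 1)
                   * real n powi (int (card W) - 2 * int (card D) - 1)))}"
    show "measure_pmf.prob (built_graph n (t n) S) ?G \<ge> 1 - \<epsilon>"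
      unfolding built_graph_bind
    proof (rule prob_bind_pmf_ge)
      fix \<rho> assume \<rho>: "\<rho> \<in> set_pmf S"
      interpret weighted_thinning n k0 "t n" "b n" \<rho> K
        using n t_range[OF n] b_range[OF n] K S \<rho> by unfold_locales (auto simp: is_strategy_def)
      have good: "purchased \<rho> es (t n) \<in> ?G"
        if "real (card (alive es (Suc (t n)))) \<ge> (1 - \<epsilon>) * real n" for es
      \<comment> \<open>The witness is taken at \<open>Suc (t n)\<close>, so that the final graph at
        time \<open>t n\<close> has itself been checked.\<close>
      proof (intro CollectI exI[of _ "alive es (Suc (t n))"] conjI alive_subset that allI impI ballI)
        fix W :: "nat set" and D v
        assume F: "connected_graph W D \<and> card W \<le> k0" and v: "v \<in> alive es (Suc (t n))"
        let ?V = "alive es (Suc (t n))"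
        from F obtain W' D' where F': "(W', D') \<in> small_connected k0" "card W' = card W" "card D' = card D"
          and le: "\<And>(V :: nat set) E v. finite V \<Longrightarrow> card (copies_at W D V E v) \<le> card (copies_at W' D' V E v)"
          using relabel_small_connected[of W D k0, where 'b = nat] by metis
        have "finite W" using F by (simp add: connected_graph_def simple_graph_def)
        then have "card (copies_at W D ?V (induced_edges (purchased \<rho> es (t n)) ?V) v)
            \<le> card (copies_at W D ?V (purchased \<rho> es (t n)) v)"
          by (intro card_mono copies_at_mono finite_copies_at finite_alive) (auto simp: induced_edges_def)
        also have "\<dots> \<le> card (copies_at W' D' ?V (purchased \<rho> es (t n)) v)"
          by (rule le[OF finite_alive])
        finally have "real (card (copies_at W D ?V (induced_edges (purchased \<rho> es (t n)) ?V) v))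
            \<le> lam * w (card W) (card D)"
          using copies_at_alive_le[OF F'(1) v] F'(2,3) by (simp add: lam_def)
        then show "real (card (copies_at W D ?V (induced_edges (purchased \<rho> es (t n)) ?V) v))
             \<le> lam * real (b n) powi (int (card W) - 1)
                   * real (t n) powi (int (card D) - int (card W) + 1)
                   * real n powi (int (card W) - 2 * int (card D) - 1)"
          by (simp add: weight_def mult.assoc)
      qed
      let ?U = "pmf_of_set orders" and ?pre = "(\<lambda>es. purchased \<rho> es (t n)) -` ?G"
      have ne: "orders \<noteq> {}" using N_pos by (auto simp: N_def)
      have "measure_pmf.prob ?U (- ?pre) = real (card (orders \<inter> - ?pre)) / real N"
        using measure_pmf_of_set[OF ne finite_orders] by (simp add: N_def)
      also have "\<dots> \<le> real (card {es \<in> orders. real (card (alive es (Suc (t n)))) < (1 - \<epsilon>) * real n}) / real N"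
        using good finite_orders
        by (intro divide_right_mono of_nat_mono card_mono) (auto simp: not_le[symmetric] simp del: alive.simps)
      also have "\<dots> \<le> \<epsilon>" using card_few_alive_le[OF eps large] N_pos by (simp add: divide_le_eq)
      finally have "1 - \<epsilon> \<le> measure_pmf.prob ?U ?pre"
        using measure_pmf.prob_compl[of ?pre ?U] by (simp add: Compl_eq_Diff_UNIV)
      then show "1 - \<epsilon> \<le> measure_pmf.prob (map_pmf (\<lambda>es. purchased \<rho> es (t n))
          (pmf_of_set (permutations_of_set (edges_K n)))) ?G"
        unfolding measure_map_pmf orders_def .
    qed
  qed
qed

end
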